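(* Let $d=1$ and let $J:\mathbb{Z}\to[0,\infty)$ satisfy $J_0=0$, $J_n=J_{-n}$ for all $n$, $\sum_m J_m<\infty$ and $J_1>0$. Suppose there exist $q>1$, $k_0\in\mathbb{N}$ and $0<C_1<C_2$ such that $C_1\le k\,(\log k)^q J_k\le C_2$ for all $k\ge k_0$. Then $\nu_0>0$ for every $p>1$.
   Context: For $u\in l^2(\mathbb{Z})$ (complex-valued) let $(Lu)_n=\sum_{m\ne n}J_{n-m}(u_n-u_m)$. For $p>1$ the excitation threshold is $$\nu_0=\sup\Big\{\nu>0:\ \|u\|_{l^{p+1}}^{p+1}\le\tfrac{p+1}{2}\nu^{-\frac{p-1}{2}}\|u\|_{l^2}^{p-1}\langle Lu,u\rangle\ \ \forall u\in l^2(\mathbb{Z})\Big\}\ge 0,$$ with $\nu_0=0$ if the set is empty. Equivalently $\nu_0=(\frac{p+1}{2}K)^{2/(p-1)}$ with $K=\inf_{u\in l^2(\mathbb{Z})\setminus\{0\}}\|u\|_{l^2}^{p-1}\langle Lu,u\rangle/\|u\|_{l^{p+1}}^{p+1}$. *)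

theory Defs
  imports "HOL-Analysis.Analysis"
begin

definition lp_space :: "real \<Rightarrow> (int \<Rightarrow> complex) set" where
  "lp_space r = {u. (\<lambda>n. cmod (u n) powr r) summable_on UNIV}"

definition lp_norm :: "real \<Rightarrow> (int \<Rightarrow> complex) \<Rightarrow> real" where
  "lp_norm r u = (\<Sum>\<^sub>\<infinity>n. cmod (u n) powr r) powr (1 / r)"

definition l2_inner :: "(int \<Rightarrow> complex) \<Rightarrow> (int \<Rightarrow> complex) \<Rightarrow> complex" where
  "l2_inner u v = (\<Sum>\<^sub>\<infinity>n. u n * cnj (v n))"

definition lattice_op :: "(int \<Rightarrow> real) \<Rightarrow> (int \<Rightarrow> complex) \<Rightarrow> int \<Rightarrow> complex" where
  "lattice_op J u n = (\<Sum>\<^sub>\<infinity>m\<in>{m. m \<noteq> n}. complex_of_real (J (n - m)) * (u n - u m))"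

text \<open>For nonnegative, even, summable \<open>J\<close> and \<open>u\<close> in \<open>l\<^sup>2\<close>, all series involved converge absolutely and
  \<open>l2_inner (lattice_op J u) u\<close> is real, so taking \<open>Re\<close> only changes its type.\<close>

definition threshold_set :: "(int \<Rightarrow> real) \<Rightarrow> real \<Rightarrow> real set" where
  "threshold_set J p = {\<nu>. \<nu> > 0 \<and> (\<forall>u\<in>lp_space 2.
     lp_norm (p + 1) u powr (p + 1)
       \<le> (p + 1) / 2 * \<nu> powr (- (p - 1) / 2) * lp_norm 2 u powr (p - 1)
           * Re (l2_inner (lattice_op J u) u))}"

text \<open>For \<open>p > 1\<close> the set is bounded above (test the inequality with a nonzero finitely supported
  \<open>u\<close>), so the real supremum is the true one whenever the set is nonempty.\<close>

definition excitation_threshold :: "(int \<Rightarrow> real) \<Rightarrow> real \<Rightarrow> real" where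
  "excitation_threshold J p =
     (if threshold_set J p = {} then 0 else Sup (threshold_set J p))"

end

theory Submission
  imports Defs
begin

text \<open>Since \<open>J\<close> has a logarithmic tail, \<open>J\<^sub>k \<ge> c k\<^sup>-\<^sup>1\<^sup>-\<^sup>e\<close> for large \<open>k\<close> and every \<open>e > 0\<close>. Fix a site
  \<open>n\<close> with \<open>a = |u\<^sub>n| > 0\<close> and let \<open>S\<close> be the squared \<open>l\<^sup>2\<close> norm of \<open>u\<close>. At most \<open>R = 4 S / a\<^sup>2\<close> sites \<open>m\<close>
  have \<open>|u\<^sub>m| \<ge> a / 2\<close>, so a window of length about \<open>2 R\<close> next to \<open>n\<close> contains at least \<open>R\<close> sites with
  \<open>|u\<^sub>n - u\<^sub>m| \<ge> a / 2\<close>. Hence the sum of \<open>J\<^sub>n\<^sub>-\<^sub>m |u\<^sub>n - u\<^sub>m|\<^sup>2\<close> over \<open>m\<close> is at least a constant times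
  \<open>R a\<^sup>2 R\<^sup>-\<^sup>1\<^sup>-\<^sup>e\<close>, that is, a constant times \<open>a\<^sup>2\<^sup>+\<^sup>2\<^sup>e S\<^sup>-\<^sup>e\<close>. With \<open>e = (p - 1) / 2\<close>, summing over \<open>n\<close>
  gives the inequality that defines the threshold.\<close>

section \<open>Comparison of logarithmic and power tails\<close>

lemma log_tail_ge_power_tail:
  fixes f :: "nat \<Rightarrow> real" and e q C :: real
  assumes "q > 0" and "C > 0" and "e > 0"
    and tail: "\<And>k. k \<ge> k0 \<Longrightarrow> C \<le> real k * ln (real k) powr q * f k"
  shows "\<exists>c>0. \<forall>k\<ge>max k0 2. c * real k powr (- 1 - e) \<le> f k"
proof (intro exI conjI allI impI)
  \<comment> \<open>The witness comes from ln x \<le> x^s / s with s = e / q: raised to the power q,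
    the right side becomes k^e / (e / q)^q. The cutoff at 2 keeps ln k positive, so that the tail
    bound forces f k > 0.\<close>
  show "C * (e / q) powr q > 0" using assms by simp
  fix k assume k: "k \<ge> max k0 2"
  then have k1: "real k > 1" by simp
  have "ln (real k) powr q \<le> (real k powr (e / q) / (e / q)) powr q"
    using ln_powr_bound[of "real k" "e / q"] assms k1 by (intro powr_mono2) auto
  also have "\<dots> = real k powr e / (e / q) powr q"
    using assms(1) assms(3) by (simp only: powr_divide powr_powr) simp
  finally have ln_le: "ln (real k) powr q \<le> real k powr e / (e / q) powr q" .
  have pos: "real k * ln (real k) powr q > 0" using k1 by simp
  have "0 < real k * ln (real k) powr q * f k"
    using tail[of k] k assms(2) by simp
  then have f: "f k > 0" using pos by (simp add: zero_less_mult_iff)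
  have "C \<le> real k * ln (real k) powr q * f k" using tail k by simp
  also have "\<dots> \<le> real k * (real k powr e / (e / q) powr q) * f k"
    using ln_le f by (intro mult_right_mono mult_left_mono) auto
  finally have "C * (e / q) powr q \<le> real k powr (1 + e) * f k"
    using assms k1 by (simp add: powr_add field_simps)
  then have "C * (e / q) powr q * real k powr (- (1 + e))
      \<le> real k powr (1 + e) * f k * real k powr (- (1 + e))"
    by (rule mult_right_mono) simp
  also have "\<dots> = real k powr (1 + e) * real k powr (- (1 + e)) * f k"
    by (simp only: mult_ac)
  also have "\<dots> = f k" using k1 by (simp only: powr_add[symmetric]) simp
  finally show "C * (e / q) powr q * real k powr (- 1 - e) \<le> f k" by simp
qed

section \<open>The quadratic form as a symmetric double sum\<close>

lemma convolution_summable: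
  fixes J w :: "int \<Rightarrow> real"
  assumes "\<And>n. J n \<ge> 0" and "\<And>n. w n \<ge> 0"
    and "J summable_on UNIV" and "w summable_on UNIV"
  shows "(\<lambda>(n, m). J (n - m) * w n) summable_on UNIV"
proof -
  have "(\<lambda>(n, k). J k * w n) summable_on (UNIV \<times> UNIV)"
  proof (rule summable_on_SigmaI)
    show "((\<lambda>k. case (n, k) of (n, k) \<Rightarrow> J k * w n) has_sum (infsum J UNIV * w n)) UNIV" for n
      using assms(3) by (auto intro: has_sum_cmult_left has_sum_infsum)
    show "(\<lambda>n. infsum J UNIV * w n) summable_on UNIV"
      using assms(4) by (rule summable_on_cmult_right)
  qed (use assms in auto)
  then have "(\<lambda>(n, k). J k * w n) summable_on UNIV" by simp
  \<comment> \<open>This involution replaces m by the difference n - m and so carries the product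
    family to the convolution kernel.\<close>
  moreover have "bij_betw (\<lambda>(n, m). (n, n - m)) UNIV (UNIV :: (int \<times> int) set)"
    by (rule bij_betwI[where g = "\<lambda>(n, m). (n, n - m)"]) auto
  ultimately show ?thesis
    by (subst (asm) summable_on_reindex_bij_betw[symmetric, of _ _ UNIV]) (auto simp: case_prod_unfold)
qed

lemma bij_swap: "bij_betw (\<lambda>(n, m). (m, n)) UNIV UNIV"
  by (rule bij_betwI[where g = "\<lambda>(n, m). (m, n)"]) auto

text \<open>Symmetrization: exchanging n and m in the double sum for the inner product and using
  that \<open>J\<close> is even, the two copies add up to a nonnegative summand. The form can then
  be bounded from below site by site, keeping only selected m.\<close>

lemma
  fixes J :: "int \<Rightarrow> real" and u :: "int \<Rightarrow> complex"
  assumes nonneg: "\<And>n. J n \<ge> 0" and zero: "J 0 = 0" and even: "\<And>n. J (- n) = J n"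
    and J_sum: "J summable_on UNIV" and u: "u \<in> lp_space 2"
  shows Dirichlet_form_summable:
      "(\<lambda>(n, m). J (n - m) * (cmod (u n - u m))\<^sup>2) summable_on UNIV"
    and Dirichlet_form_eq:
      "(\<Sum>\<^sub>\<infinity>(n, m). J (n - m) * (cmod (u n - u m))\<^sup>2) = 2 * Re (l2_inner (lattice_op J u) u)"
proof -
  define F where "F = (\<lambda>(n, m). complex_of_real (J (n - m)) * (u n - u m) * cnj (u n))"
  let ?s = "\<lambda>(n, m). (m, n)"
  have w: "(\<lambda>n. (cmod (u n))\<^sup>2) summable_on UNIV"
    using u by (simp add: lp_space_def)
  have J_swap: "J (m - n) = J (n - m)" for n m
    using even[of "n - m"] by simp
  have A: "(\<lambda>(n, m). J (n - m) * (cmod (u n))\<^sup>2) summable_on UNIV"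
    using nonneg w J_sum by (intro convolution_summable) auto
  then have B: "(\<lambda>(n, m). J (n - m) * (cmod (u m))\<^sup>2) summable_on UNIV"
    using bij_swap
    by (subst (asm) summable_on_reindex_bij_betw[symmetric, of ?s UNIV]) (auto simp: case_prod_unfold J_swap)
  \<comment> \<open>Absolute summability of the unsymmetrized summand \<open>F\<close> justifies
    both the iterated summation and the exchange of indices below.\<close>
  have "(\<lambda>x. norm (F x)) summable_on UNIV"
  proof (rule summable_on_comparison_test)
    show "(\<lambda>x. 2 * ((\<lambda>(n, m). J (n - m) * (cmod (u n))\<^sup>2) x + (\<lambda>(n, m). J (n - m) * (cmod (u m))\<^sup>2) x))
        summable_on UNIV"
      by (intro summable_on_cmult_right summable_on_add A B)
    fix x :: "int \<times> int"
    obtain n m where x: "x = (n, m)" by force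
    have "cmod (u n - u m) * cmod (u n) \<le> (cmod (u n) + cmod (u m)) * cmod (u n)"
      by (intro mult_right_mono norm_triangle_ineq4) auto
    also have "\<dots> \<le> 2 * ((cmod (u n))\<^sup>2 + (cmod (u m))\<^sup>2)"
      using sum_squares_bound[of "cmod (u n)" "cmod (u m)"]
      by (simp add: algebra_simps power2_eq_square)
         (smt (verit) zero_le_square)
    finally have "J (n - m) * (cmod (u n - u m) * cmod (u n))
        \<le> J (n - m) * (2 * ((cmod (u n))\<^sup>2 + (cmod (u m))\<^sup>2))"
      using nonneg by (rule mult_left_mono)
    then show "norm (F x) \<le> 2 * ((\<lambda>(n, m). J (n - m) * (cmod (u n))\<^sup>2) x
        + (\<lambda>(n, m). J (n - m) * (cmod (u m))\<^sup>2) x)"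
      using nonneg[of "n - m"] unfolding x F_def norm_mult prod.case complex_mod_cnj norm_of_real
      by (simp only: abs_of_nonneg distrib_left mult.assoc mult.left_commute[of "J (n - m)" 2])
  qed auto
  then have F: "F summable_on UNIV" by (rule abs_summable_summable)
  then have Fs: "(\<lambda>x. F (?s x)) summable_on UNIV"
    using bij_swap by (subst summable_on_reindex_bij_betw[of ?s UNIV UNIV]) auto
  have D: "(\<lambda>(n, m). J (n - m) * (cmod (u n - u m))\<^sup>2) = (\<lambda>x. Re (F x) + Re (F (?s x)))"
  proof
    fix x :: "int \<times> int"
    obtain n m where x: "x = (n, m)" by force
    have "Re (F x) + Re (F (?s x)) =
        J (n - m) * Re ((u n - u m) * cnj (u n) + (u m - u n) * cnj (u m))"
      unfolding x F_def by (simp add: J_swap[of m n] algebra_simps)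
    also have "Re ((u n - u m) * cnj (u n) + (u m - u n) * cnj (u m)) = (cmod (u n - u m))\<^sup>2"
      unfolding cmod_power2 by (simp add: power2_eq_square algebra_simps)
    finally show "(\<lambda>(n, m). J (n - m) * (cmod (u n - u m))\<^sup>2) x = Re (F x) + Re (F (?s x))"
      by (simp add: x)
  qed
  show "(\<lambda>(n, m). J (n - m) * (cmod (u n - u m))\<^sup>2) summable_on UNIV"
    unfolding D by (intro summable_on_add summable_on_Re F Fs)
  have "infsum F UNIV = infsum F (UNIV \<times> UNIV)" by simp
  also have "\<dots> = (\<Sum>\<^sub>\<infinity>n. \<Sum>\<^sub>\<infinity>m. F (n, m))"
    using F by (intro infsum_Sigma_banach[symmetric]) simp
  \<comment> \<open>The diagonal terms of \<open>F\<close> vanish, so the sum over m different from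
    n in \<open>lattice_op\<close> extends to all m.\<close>
  also have "\<dots> = l2_inner (lattice_op J u) u"
    unfolding l2_inner_def lattice_op_def infsum_cmult_left'[symmetric]
    by (intro infsum_cong infsum_cong_neutral) (auto simp: F_def zero)
  finally have "infsum F UNIV = l2_inner (lattice_op J u) u" .
  moreover have "infsum (\<lambda>x. F (?s x)) UNIV = infsum F UNIV"
    using bij_swap by (rule infsum_reindex_bij_betw)
  ultimately show "(\<Sum>\<^sub>\<infinity>(n, m). J (n - m) * (cmod (u n - u m))\<^sup>2)
      = 2 * Re (l2_inner (lattice_op J u) u)"
    unfolding D by (simp add: infsum_add summable_on_Re F Fs infsum_Re)
qed

section \<open>Local energy estimate and interpolation inequality\<close>

lemma local_energy_ge:
  fixes J :: "int \<Rightarrow> real" and u :: "int \<Rightarrow> complex" and c e S :: real and K :: nat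
  assumes nonneg: "\<And>n. J n \<ge> 0" and even: "\<And>n. J (- n) = J n"
    and c: "c > 0" and e: "e > 0"
    and tail: "\<And>k. k \<ge> K \<Longrightarrow> k > 0 \<Longrightarrow> c * real k powr (- 1 - e) \<le> J (int k)"
    and w: "(\<lambda>n. (cmod (u n))\<^sup>2) summable_on UNIV"
    and S: "S = (\<Sum>\<^sub>\<infinity>n. (cmod (u n))\<^sup>2)"
    and E: "(\<lambda>m. J (n - m) * (cmod (u n - u m))\<^sup>2) summable_on UNIV"
  shows "c * (real K + 3) powr (- 1 - e) * 4 powr (- 1 - e) * cmod (u n) powr (2 + 2 * e)
    \<le> S powr e * (\<Sum>\<^sub>\<infinity>m. J (n - m) * (cmod (u n - u m))\<^sup>2)"
\<comment> \<open>The number \<open>R\<close> below divides by the squared modulus of u n; where u n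
  vanishes, the left side is 0.\<close>
proof (cases "u n = 0")
  case True
  have "0 \<le> (\<Sum>\<^sub>\<infinity>m. J (n - m) * (cmod (u n - u m))\<^sup>2)"
    using nonneg by (intro infsum_nonneg) auto
  then show ?thesis using True e by simp
next
  case False
  define a where "a = cmod (u n)"
  define R where "R = 4 * S / a\<^sup>2"
  \<comment> \<open>Rounding up adds less than 1, and R \<ge> 4, so N lies between 2 R and 3
    R.\<close>
  define N where "N = nat \<lceil>2 * R\<rceil>"
  \<comment> \<open>The window starts beyond distance K, so the tail bound holds at each of its
    sites. The set \<open>B\<close> collects its bad sites, at most R of them by Chebyshev's
    inequality.\<close>
  define A where "A = (\<lambda>k. n + int k) ` {K<..K + N}"
  define B where "B = {m \<in> A. a / 2 \<le> cmod (u m)}"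
  have a: "a > 0" using False by (simp add: a_def)
  have sum_le: "(\<Sum>m\<in>X. (cmod (u m))\<^sup>2) \<le> S" if "finite X" for X
    unfolding S using w that by (intro finite_sum_le_infsum) auto
  have "a\<^sup>2 \<le> S" using sum_le[of "{n}"] by (simp add: a_def)
  then have S0: "S > 0" using a by (smt (verit) zero_less_power)
  have R: "R \<ge> 4" using \<open>a\<^sup>2 \<le> S\<close> a by (simp add: R_def field_simps)
  have N: "2 * R \<le> real N" "real N \<le> 3 * R" using R unfolding N_def by linarith+
  have fin: "finite A" by (simp add: A_def)
  have cardA: "card A = N" unfolding A_def by (subst card_image) (auto simp: inj_on_def)
  have "real (card B) * (a / 2)\<^sup>2 = (\<Sum>m\<in>B. (a / 2)\<^sup>2)" by simp
  also have "\<dots> \<le> (\<Sum>m\<in>B. (cmod (u m))\<^sup>2)"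
    using a by (intro sum_mono power_mono) (auto simp: B_def)
  also have "\<dots> \<le> S" using fin by (intro sum_le) (simp add: B_def)
  finally have "real (card B) \<le> R" using a by (simp add: R_def field_simps power2_eq_square)
  moreover have "card (A - B) = N - card B" "card B \<le> N"
    using fin cardA by (auto simp: B_def card_Diff_subset card_mono intro: card_mono)
  ultimately have good: "R \<le> real (card (A - B))" using N by (simp add: of_nat_diff)
  \<comment> \<open>A bound for each good summand: every distance in the window is at most K + N
    \<le> (K + 3) R, and the factor a^2 / 4 comes from |u n - u m| \<ge> a / 2.\<close>
  let ?b = "c * ((real K + 3) * R) powr (- 1 - e) * (a\<^sup>2 / 4)"
  have "R * ?b \<le> real (card (A - B)) * ?b" using good c by (intro mult_right_mono) auto
  also have "\<dots> = (\<Sum>m\<in>A - B. ?b)" by simp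
  also have "\<dots> \<le> (\<Sum>m\<in>A - B. J (n - m) * (cmod (u n - u m))\<^sup>2)"
  proof (rule sum_mono)
    fix m assume m: "m \<in> A - B"
    then obtain k where k: "m = n + int k" "K < k" "k \<le> K + N" by (auto simp: A_def)
    have "real k \<le> real K + real N" using k by linarith
    also have "\<dots> \<le> real K * R + 3 * R"
      using N R mult_left_mono[of 1 R "real K"] by simp
    finally have kR: "real k \<le> (real K + 3) * R" by (simp add: algebra_simps)
    have "c * ((real K + 3) * R) powr (- 1 - e) \<le> c * real k powr (- 1 - e)"
      using c e k kR by (intro mult_left_mono powr_mono2') auto
    also have "\<dots> \<le> J (n - m)" using tail[of k] k even by simp
    finally have J: "c * ((real K + 3) * R) powr (- 1 - e) \<le> J (n - m)" .
    have "cmod (u m) < a / 2" using m by (auto simp: B_def)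
    then have "a / 2 \<le> cmod (u n - u m)"
      using norm_triangle_ineq2[of "u n" "u m"] by (simp add: a_def)
    then have "(a / 2)\<^sup>2 \<le> (cmod (u n - u m))\<^sup>2" using a by (intro power_mono) auto
    then have "a\<^sup>2 / 4 \<le> (cmod (u n - u m))\<^sup>2" by (simp add: power_divide)
    then show "?b \<le> J (n - m) * (cmod (u n - u m))\<^sup>2"
      using J nonneg by (intro mult_mono) auto
  qed
  also have "\<dots> \<le> (\<Sum>\<^sub>\<infinity>m. J (n - m) * (cmod (u n - u m))\<^sup>2)"
    using E fin nonneg by (intro finite_sum_le_infsum) auto
  finally have main: "R * ?b \<le> (\<Sum>\<^sub>\<infinity>m. J (n - m) * (cmod (u n - u m))\<^sup>2)" .
  have R_powr: "R * R powr (- 1 - e) = R powr (- e)"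
    using R powr_mult_base[of R "- 1 - e"] by simp
  \<comment> \<open>As R = 4 S / a^2, the factor S^e cancels the S in R^(-e) and leaves a pure power
    of a.\<close>
  have balance: "S powr e * R powr (- e) * a\<^sup>2 = 4 powr (- e) * a powr (2 + 2 * e)"
  proof -
    have "R powr (- e) = 4 powr (- e) * S powr (- e) * (a powr 2) powr e"
      unfolding R_def using a S0
      by (simp add: powr_mult powr_divide powr_minus_divide)
    moreover have "S powr e * S powr (- e) = 1" using S0 by (simp add: powr_minus)
    moreover have "(a powr 2) powr e * a\<^sup>2 = a powr (2 + 2 * e)"
      using a by (simp only: powr_powr powr_add) simp
    ultimately show ?thesis by (simp add: algebra_simps)
  qed
  have "S powr e * (R * ?b) =
      c * (real K + 3) powr (- 1 - e) * (S powr e * (R * R powr (- 1 - e)) * a\<^sup>2) / 4"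
    using R by (subst powr_mult) (auto simp: algebra_simps)
  also have "\<dots> = c * (real K + 3) powr (- 1 - e) * (4 powr (- e) / 4) * a powr (2 + 2 * e)"
    unfolding R_powr balance by simp
  also have "(4::real) powr (- e) / 4 = 4 powr (- 1 - e)"
    by (simp add: powr_diff powr_minus_divide)
  finally have "S powr e * (R * ?b) =
      c * (real K + 3) powr (- 1 - e) * 4 powr (- 1 - e) * a powr (2 + 2 * e)" .
  then show ?thesis
    using mult_left_mono[OF main, of "S powr e"] by (simp only: a_def) simp
qed

text \<open>The local estimates are summed over n. The choice e = (p - 1) / 2 makes 2 + 2 e equal to
  p + 1 and S^e equal to the (p - 1)-th power of the \<open>l2\<close> norm. The 2 in the constant 2
  / b is the factor from the symmetrized form.\<close>

lemma interpolation_inequality: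
  fixes J :: "int \<Rightarrow> real" and c p :: real and K :: nat
  assumes nonneg: "\<And>n. J n \<ge> 0" and zero: "J 0 = 0" and even: "\<And>n. J (- n) = J n"
    and J_sum: "J summable_on UNIV" and p: "p > 1" and c: "c > 0"
    and tail: "\<And>k. k \<ge> K \<Longrightarrow> k > 0 \<Longrightarrow> c * real k powr (- 1 - (p - 1) / 2) \<le> J (int k)"
  shows "\<exists>C>0. \<forall>u\<in>lp_space 2. lp_norm (p + 1) u powr (p + 1)
    \<le> C * lp_norm 2 u powr (p - 1) * Re (l2_inner (lattice_op J u) u)"
proof -
  define e where "e = (p - 1) / 2"
  define b where "b = c * (real K + 3) powr (- 1 - e) * 4 powr (- 1 - e)"
  have e: "e > 0" and b: "b > 0" using p c by (auto simp: e_def b_def)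
  show ?thesis
  proof (intro exI conjI ballI)
    show "2 / b > 0" using b by simp
    fix u assume u: "u \<in> lp_space 2"
    define S where "S = (\<Sum>\<^sub>\<infinity>n. (cmod (u n))\<^sup>2)"
    define D where "D = (\<lambda>n. \<Sum>\<^sub>\<infinity>m. J (n - m) * (cmod (u n - u m))\<^sup>2)"
    have w: "(\<lambda>n. (cmod (u n))\<^sup>2) summable_on UNIV"
      using u by (simp add: lp_space_def)
    have form: "(\<lambda>(n, m). J (n - m) * (cmod (u n - u m))\<^sup>2) summable_on (UNIV \<times> UNIV)"
      using Dirichlet_form_summable[OF nonneg zero even J_sum u] by simp
    have inner: "(\<lambda>m. J (n - m) * (cmod (u n - u m))\<^sup>2) summable_on UNIV" for n
      using summable_on_SigmaD1[OF form, of n] nonneg by simp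
    have D_sum: "D summable_on UNIV"
      unfolding D_def using summable_on_Sigma_banach[OF form] by simp
    have "infsum D UNIV = (\<Sum>\<^sub>\<infinity>(n, m). J (n - m) * (cmod (u n - u m))\<^sup>2)"
      unfolding D_def using infsum_Sigma'_banach[OF form] by simp
    then have D: "infsum D UNIV = 2 * Re (l2_inner (lattice_op J u) u)"
      using Dirichlet_form_eq[OF nonneg zero even J_sum u] by simp
    have "b * cmod (u n) powr (2 + 2 * e) \<le> S powr e * D n" for n
      unfolding b_def D_def
      by (rule local_energy_ge[OF nonneg even c e _ w S_def inner]) (use tail in \<open>auto simp: e_def\<close>)
    moreover have "p + 1 = 2 + 2 * e" by (simp add: e_def field_simps)
    ultimately have le: "cmod (u n) powr (p + 1) \<le> S powr e / b * D n" for n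
      using b by (simp only: pos_le_divide_eq times_divide_eq_left mult.commute[of _ b])
    have RHS: "(\<lambda>n. S powr e / b * D n) summable_on UNIV"
      using D_sum by (rule summable_on_cmult_right)
    \<comment> \<open>Summability shows that the infinite sum in \<open>lp_norm (p + 1) u\<close> is
      a genuine one and not the default value 0.\<close>
    have "(\<lambda>n. cmod (u n) powr (p + 1)) summable_on UNIV"
      using RHS le by (rule summable_on_comparison_test) auto
    then have "(\<Sum>\<^sub>\<infinity>n. cmod (u n) powr (p + 1)) \<le> (\<Sum>\<^sub>\<infinity>n. S powr e / b * D n)"
      using RHS le by (rule infsum_mono)
    also have "\<dots> = 2 / b * S powr e * Re (l2_inner (lattice_op J u) u)"
      unfolding infsum_cmult_right' D by simp
    also have "(\<Sum>\<^sub>\<infinity>n. cmod (u n) powr (p + 1)) = lp_norm (p + 1) u powr (p + 1)"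
      using p by (simp add: lp_norm_def powr_powr infsum_nonneg)
    also have "S powr e = lp_norm 2 u powr (p - 1)"
      by (simp add: lp_norm_def S_def powr_powr e_def)
    finally show "lp_norm (p + 1) u powr (p + 1)
      \<le> 2 / b * lp_norm 2 u powr (p - 1) * Re (l2_inner (lattice_op J u) u)" .
  qed
qed

section \<open>Bounds on the threshold\<close>

lemma threshold_set_bdd_above:
  assumes p: "p > 1"
  shows "bdd_above (threshold_set J p)"
proof -
  \<comment> \<open>For the indicator of site 0 all norms equal 1, so the defining inequality can be
    solved for \<nu> in terms of the fixed number \<open>E\<close>.\<close>
  define u :: "int \<Rightarrow> complex" where "u n = of_bool (n = 0)" for n
  define E where "E = Re (l2_inner (lattice_op J u) u)"
  have u_has_sum: "((\<lambda>n. cmod (u n) powr r) has_sum 1) UNIV" for r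
    by (rule has_sum_finite_neutralI[of "{0}"]) (auto simp: u_def)
  then have norm: "lp_norm r u = 1" for r
    by (simp add: lp_norm_def infsumI[OF u_has_sum])
  have u: "u \<in> lp_space 2" unfolding lp_space_def summable_on_def using u_has_sum by blast
  have "\<nu> \<le> ((p + 1) / 2 * E) powr (2 / (p - 1))" if "\<nu> \<in> threshold_set J p" for \<nu>
  proof -
    have \<nu>: "\<nu> > 0" using that by (simp add: threshold_set_def)
    have "1 \<le> (p + 1) / 2 * \<nu> powr (- (p - 1) / 2) * E"
      using that u norm by (auto simp: threshold_set_def E_def)
    then have "\<nu> powr ((p - 1) / 2) * 1
        \<le> \<nu> powr ((p - 1) / 2) * ((p + 1) / 2 * \<nu> powr (- (p - 1) / 2) * E)"
      by (rule mult_left_mono) simp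
    also have "\<dots> = (\<nu> powr ((p - 1) / 2) * \<nu> powr (- (p - 1) / 2)) * ((p + 1) / 2 * E)"
      by (simp only: mult_ac)
    also have "\<nu> powr ((p - 1) / 2) * \<nu> powr (- (p - 1) / 2) = 1"
      using \<nu> by (simp flip: powr_add add: diff_divide_distrib)
    finally have "(\<nu> powr ((p - 1) / 2)) powr (2 / (p - 1)) \<le> ((p + 1) / 2 * E) powr (2 / (p - 1))"
      using p by (intro powr_mono2) auto
    moreover have exponent: "(p - 1) / 2 * (2 / (p - 1)) = 1" using p by simp
    have "(\<nu> powr ((p - 1) / 2)) powr (2 / (p - 1)) = \<nu>"
      unfolding powr_powr exponent using \<nu> by simp
    ultimately show ?thesis by simp
  qed
  then show ?thesis by (rule bdd_aboveI)
qed

lemma excitation_threshold_pos: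
  assumes p: "p > 1" and C: "C > 0"
    and le: "\<And>u. u \<in> lp_space 2 \<Longrightarrow> lp_norm (p + 1) u powr (p + 1)
      \<le> C * lp_norm 2 u powr (p - 1) * Re (l2_inner (lattice_op J u) u)"
  shows "excitation_threshold J p > 0"
proof -
  \<comment> \<open>This solves (p + 1) / 2 * \<nu>^(-(p - 1) / 2) = C.\<close>
  define \<nu> where "\<nu> = (2 * C / (p + 1)) powr (- 2 / (p - 1))"
  have \<nu>: "\<nu> > 0" using p C by (simp add: \<nu>_def)
  have "- 2 / (p - 1) * (- (p - 1) / 2) = 1" using p by (simp add: field_simps)
  then have "\<nu> powr (- (p - 1) / 2) = 2 * C / (p + 1)"
    unfolding \<nu>_def powr_powr using p C by simp
  then have eq: "(p + 1) / 2 * \<nu> powr (- (p - 1) / 2) = C" using p by (simp add: field_simps)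
  have mem: "\<nu> \<in> threshold_set J p"
    unfolding threshold_set_def mem_Collect_eq eq using \<nu> le by blast
  then have "\<nu> \<le> Sup (threshold_set J p)"
    using threshold_set_bdd_above[OF p] by (rule cSup_upper)
  then show ?thesis using \<nu> mem by (auto simp: excitation_threshold_def)
qed

theorem corollary3p1:
  fixes J :: "int \<Rightarrow> real"
  assumes J_nonneg: "\<forall>n. J n \<ge> 0"
    and J_zero: "J 0 = 0"
    and J_even: "\<forall>n. J n = J (- n)"
    and J_summable: "J summable_on UNIV"
    and J_one: "J 1 > 0"
    and J_decay: "\<exists>(q::real) (k\<^sub>0::nat) (C\<^sub>1::real) (C\<^sub>2::real).
      q > 1 \<and> 0 < C\<^sub>1 \<and> C\<^sub>1 < C\<^sub>2 \<and>
      (\<forall>k::nat. k \<ge> k\<^sub>0 \<longrightarrow>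
        C\<^sub>1 \<le> real k * ln (real k) powr q * J (int k) \<and>
        real k * ln (real k) powr q * J (int k) \<le> C\<^sub>2)"
  shows "\<forall>p::real. p > 1 \<longrightarrow> excitation_threshold J p > 0"
proof (intro allI impI)
  fix p :: real assume p: "p > 1"
  obtain q k0 C1 where "q > 1" "0 < C1"
    and tail: "\<And>k. k \<ge> k0 \<Longrightarrow> C1 \<le> real k * ln (real k) powr q * J (int k)"
    using J_decay by blast
  \<comment> \<open>The logarithmic tail dominates a power tail for every e > 0, so e can be matched
    to any p > 1, however close to 1.\<close>
  then obtain c where c: "c > 0"
    and "\<And>k. k \<ge> max k0 2 \<Longrightarrow> c * real k powr (- 1 - (p - 1) / 2) \<le> J (int k)"
    using log_tail_ge_power_tail[of q C1 "(p - 1) / 2" k0 "\<lambda>k. J (int k)"] p by auto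
  moreover have "J (- n) = J n" for n using J_even by metis
  ultimately obtain C where "C > 0" and "\<forall>u\<in>lp_space 2. lp_norm (p + 1) u powr (p + 1)
      \<le> C * lp_norm 2 u powr (p - 1) * Re (l2_inner (lattice_op J u) u)"
    using interpolation_inequality[of J p c "max k0 2"] J_nonneg J_zero J_summable p by blast
  then show "excitation_threshold J p > 0"
    using p by (intro excitation_threshold_pos) auto
qed

end
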